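(* Let $I\subset S$ be a bihomogeneous ideal defining an empty subvariety of $\mathbb{P}^n \times \mathbb{P}^m$. If $(a,b) \in \operatorname{reg}(I)$, then $\operatorname{bigin}(I)$ has no minimal generator of bidegree $(a',b')$ for any $(a',b') \gneq (a,b)$.
   Context: Let $\mathbf{k}$ be a field of characteristic $0$ and $S=\mathbf{k}[x_0,\dots,x_n,y_0,\dots,y_m]$ with the standard $\mathbb{Z}^2$-grading $\deg(x_i)=(1,0)$, $\deg(y_j)=(0,1)$; $S$ is the coordinate ring of $\mathbb{P}^n\times\mathbb{P}^m$. An ideal of $S$ is bihomogeneous if it is generated by bihomogeneous polynomials. For pairs in $\mathbb{Z}^2$, $(a',b')\geq(a,b)$ means $a'\geq a$ and $b'\geq b$, and $(a',b')\gneq(a,b)$ means $(a',b')\geq(a,b)$ and $(a',b')\neq(a,b)$. Let $\mathfrak{m}_x=(x_0,\dots,x_n)$, $\mathfrak{m}_y=(y_0,\dots,y_m)$ and $\mathfrak{b}=\mathfrak{m}_x\mathfrak{m}_y$ (the irrelevant ideal). $I$ defines an empty subvariety (subscheme) of $\mathbb{P}^n\times\mathbb{P}^m$ iff $\mathfrak{b}^t\subset I$ for some $t\geq 0$. $H^i_{\mathfrak{b}}$ denotes local cohomology with respect to $\mathfrak{b}$. The bigraded Castelnuovo-Mumford regularity $\operatorname{reg}(I)$ is the set of $(a,b)\in\mathbb{Z}^2$ such that for all $i\geq 1$, all $\lambda_x,\lambda_y\in\mathbb{Z}_{\geq 0}$ with $\lambda_x+\lambda_y=i-1$, and all $(a',b')\geq(a-\lambda_x,b-\lambda_y)$,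 one has $H^i_{\mathfrak{b}}(I)_{(a',b')}=0$. Monomial order: the degree reverse lexicographical order with $x_0<\dots<x_n<y_0<\dots<y_m$, so that for two monomials of the same bidegree, $x^{\alpha}y^{\beta}<x^{\alpha'}y^{\beta'}$ iff the leftmost nonzero entry of $(\alpha'-\alpha,\beta'-\beta)=(\alpha'_0-\alpha_0,\dots,\alpha'_n-\alpha_n,\beta'_0-\beta_0,\dots,\beta'_m-\beta_m)$ is negative. $\operatorname{in}(I)$ is the ideal generated by the leading monomials of the elements of $I$. A block-diagonal matrix $u=(u^x,u^y)\in \mathrm{GL}(n+1)\times\mathrm{GL}(m+1)$ acts on $S$ by $x_i\mapsto\sum_j u^x_{ij}x_j$, $y_i\mapsto\sum_j u^y_{ij}y_j$; $u\circ I$ is the image of $I$. The bigeneric initial ideal $\operatorname{bigin}(I)$ is the monomial ideal such that $\operatorname{in}(u\circ I)=\operatorname{bigin}(I)$ for all $u$ in a nonempty Zariski open subset of $\mathrm{GL}(n+1)\times\mathrm{GL}(m+1)$ (it is known to exist). *)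

theory Defs
  imports "HOL-Library.Poly_Mapping" "HOL-Analysis.Determinants"
begin

section \<open>The bigraded polynomial ring and its Laurent extension\<close>

text \<open>
  The index types \<open>'n\<close> and \<open>'m\<close> are finite linear orders and play the role of \<open>{0,...,n}\<close> and
  \<open>{0,...,m}\<close>, so \<open>CARD('n) = n + 1\<close> and \<open>CARD('m) = m + 1\<close>. Variables are ordered by position,
  \<open>x_0, ..., x_n, y_0, ..., y_m\<close>.
\<close>

datatype ('n, 'm) var = X 'n | Y 'm

instantiation var :: (linorder, linorder) linorder
begin

fun less_eq_var :: "('a, 'b) var \<Rightarrow> ('a, 'b) var \<Rightarrow> bool" where
  "less_eq_var (X i) (X j) \<longleftrightarrow> i \<le> j"
| "less_eq_var (X i) (Y j) \<longleftrightarrow> True"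
| "less_eq_var (Y i) (X j) \<longleftrightarrow> False"
| "less_eq_var (Y i) (Y j) \<longleftrightarrow> i \<le> j"

definition less_var :: "('a, 'b) var \<Rightarrow> ('a, 'b) var \<Rightarrow> bool" where
  "less_var v w \<longleftrightarrow> v \<le> w \<and> \<not> w \<le> v"

instance
proof
  fix u v w :: "('a, 'b) var"
  show "v < w \<longleftrightarrow> v \<le> w \<and> \<not> w \<le> v" by (simp add: less_var_def)
  show "v \<le> v" by (cases v) auto
  show "u \<le> v \<Longrightarrow> v \<le> w \<Longrightarrow> u \<le> w" by (cases u; cases v; cases w) auto
  show "v \<le> w \<Longrightarrow> w \<le> v \<Longrightarrow> v = w" by (cases v; cases w) auto
  show "v \<le> w \<or> w \<le> v" by (cases v; cases w) auto
qed

end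

lemma UNIV_var: "(UNIV :: ('n, 'm) var set) = range X \<union> range Y"
proof -
  have "v \<in> range X \<union> range Y" for v :: "('n, 'm) var"
    by (cases v) auto
  then show ?thesis by blast
qed

instance var :: (finite, finite) finite
  by standard (simp add: UNIV_var)

type_synonym ('n, 'm) expo = "('n, 'm) var \<Rightarrow>\<^sub>0 nat"
type_synonym ('n, 'm, 'k) bipoly = "('n, 'm) expo \<Rightarrow>\<^sub>0 'k"
type_synonym ('n, 'm, 'k) laurent = "(('n, 'm) var \<Rightarrow>\<^sub>0 int) \<Rightarrow>\<^sub>0 'k"

definition monom :: "('v \<Rightarrow>\<^sub>0 nat) \<Rightarrow> ('v \<Rightarrow>\<^sub>0 nat) \<Rightarrow>\<^sub>0 'k::zero_neq_one" where
  "monom e = Poly_Mapping.single e 1"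

definition const_poly :: "'k::zero \<Rightarrow> ('v \<Rightarrow>\<^sub>0 nat) \<Rightarrow>\<^sub>0 'k" where
  "const_poly c = Poly_Mapping.single 0 c"

definition var_poly :: "'v \<Rightarrow> ('v \<Rightarrow>\<^sub>0 nat) \<Rightarrow>\<^sub>0 'k::zero_neq_one" where
  "var_poly v = monom (Poly_Mapping.single v 1)"

text \<open>Evaluation of a polynomial at the point \<open>s\<close>, the coefficients being mapped by \<open>h\<close>.\<close>

definition poly_eval ::
    "('k::zero \<Rightarrow> 'r::comm_semiring_1) \<Rightarrow> ('v::finite \<Rightarrow> 'r) \<Rightarrow> (('v \<Rightarrow>\<^sub>0 nat) \<Rightarrow>\<^sub>0 'k) \<Rightarrow> 'r" where
  "poly_eval h s p =
    (\<Sum>e\<in>Poly_Mapping.keys p. h (Poly_Mapping.lookup p e) * (\<Prod>v\<in>UNIV. s v ^ Poly_Mapping.lookup e v))"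

definition bidegree :: "(('n::finite, 'm::finite) var \<Rightarrow>\<^sub>0 'a::comm_monoid_add) \<Rightarrow> 'a \<times> 'a" where
  "bidegree e = ((\<Sum>i\<in>UNIV. Poly_Mapping.lookup e (X i)), (\<Sum>j\<in>UNIV. Poly_Mapping.lookup e (Y j)))"

text \<open>The zero polynomial is bihomogeneous of every bidegree.\<close>

definition bihomogeneous_of ::
    "'a \<times> 'a \<Rightarrow> ((('n::finite, 'm::finite) var \<Rightarrow>\<^sub>0 'a::comm_monoid_add) \<Rightarrow>\<^sub>0 'k::zero) \<Rightarrow> bool" where
  "bihomogeneous_of d p \<longleftrightarrow> (\<forall>e\<in>Poly_Mapping.keys p. bidegree e = d)"

definition to_int_expo :: "('n, 'm) expo \<Rightarrow> ('n, 'm) var \<Rightarrow>\<^sub>0 int" where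
  "to_int_expo e = Poly_Mapping.map int e"

definition to_laurent :: "('n, 'm, 'k::comm_ring_1) bipoly \<Rightarrow> ('n, 'm, 'k) laurent" where
  "to_laurent p =
    (\<Sum>e\<in>Poly_Mapping.keys p. Poly_Mapping.single (to_int_expo e) (Poly_Mapping.lookup p e))"


section \<open>Ideals\<close>

text \<open>An ideal of a commutative ring is a subspace of the ring as a module over itself, and the
  ideal generated by a set is its linear span.\<close>

global_interpretation ring_ideal: module "(*) :: 'a::comm_ring_1 \<Rightarrow> 'a \<Rightarrow> 'a"
  by standard (auto simp: algebra_simps)

definition ideal_mult :: "'a::comm_ring_1 set \<Rightarrow> 'a set \<Rightarrow> 'a set" where
  "ideal_mult A B = ring_ideal.span {p * q | p q. p \<in> A \<and> q \<in> B}"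

fun ideal_power :: "'a::comm_ring_1 set \<Rightarrow> nat \<Rightarrow> 'a set" where
  "ideal_power A 0 = UNIV"
| "ideal_power A (Suc t) = ideal_mult A (ideal_power A t)"

definition bihomogeneous_ideal :: "('n::finite, 'm::finite, 'k::comm_ring_1) bipoly set \<Rightarrow> bool" where
  "bihomogeneous_ideal I \<longleftrightarrow> (\<exists>B. (\<forall>p\<in>B. \<exists>d. bihomogeneous_of d p) \<and> I = ring_ideal.span B)"

definition irrelevant_ideal :: "('n, 'm, 'k::comm_ring_1) bipoly set" where
  "irrelevant_ideal =
    ideal_mult (ring_ideal.span (range (\<lambda>i. var_poly (X i)))) (ring_ideal.span (range (\<lambda>j. var_poly (Y j))))"

definition defines_empty_subscheme :: "('n, 'm, 'k::comm_ring_1) bipoly set \<Rightarrow> bool" where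
  "defines_empty_subscheme I \<longleftrightarrow> (\<exists>t. ideal_power irrelevant_ideal t \<subseteq> I)"


section \<open>Local cohomology and regularity\<close>

text \<open>
  Local cohomology with respect to the irrelevant ideal is computed by the Cech complex on its
  generators \<open>x_i y_j\<close>. Since \<open>S\<close> is a domain, the localization \<open>I_f\<close> of an ideal \<open>I\<close> at a monomial
  \<open>f\<close> is a submodule of the Laurent polynomial ring: it consists of those \<open>g\<close> with \<open>f^N g \<in> I\<close> for
  some \<open>N\<close>, and its grading is the restriction of the grading of Laurent polynomials.
\<close>

definition localization ::
    "('n, 'm, 'k::comm_ring_1) bipoly set \<Rightarrow> ('n, 'm, 'k) bipoly \<Rightarrow> ('n, 'm, 'k) laurent set" where
  "localization I f = {g. \<exists>N. to_laurent f ^ N * g \<in> to_laurent ` I}"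

definition cech_monomial :: "('n \<times> 'm) set \<Rightarrow> ('n, 'm, 'k::comm_ring_1) bipoly" where
  "cech_monomial T = (\<Prod>(i, j)\<in>T. var_poly (X i) * var_poly (Y j))"

text \<open>The component of bidegree \<open>d\<close> of the \<open>p\<close>-th term, the direct sum of the localizations of \<open>I\<close>
  at \<open>cech_monomial T\<close> over all \<open>T\<close> with \<open>p\<close> elements. Cochains are extended by zero to other \<open>T\<close>.\<close>

definition cech_cochains ::
    "('n::finite, 'm::finite, 'k::comm_ring_1) bipoly set \<Rightarrow> nat \<Rightarrow> int \<times> int \<Rightarrow>
      (('n \<times> 'm) set \<Rightarrow> ('n, 'm, 'k) laurent) set" where
  "cech_cochains I p d =
    {c. (\<forall>T. card T = p \<longrightarrow> c T \<in> localization I (cech_monomial T) \<and> bihomogeneous_of d (c T)) \<and>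
        (\<forall>T. card T \<noteq> p \<longrightarrow> c T = 0)}"

text \<open>The signs refer to the lexicographic order on the index pairs \<open>(i, j)\<close>.\<close>

definition cech_pos :: "('n::linorder \<times> 'm::linorder) set \<Rightarrow> 'n \<times> 'm \<Rightarrow> nat" where
  "cech_pos T t = card {s \<in> T. fst s < fst t \<or> fst s = fst t \<and> snd s < snd t}"

definition cech_diff ::
    "(('n::linorder \<times> 'm::linorder) set \<Rightarrow> ('n, 'm, 'k::comm_ring_1) laurent) \<Rightarrow>
      (('n \<times> 'm) set \<Rightarrow> ('n, 'm, 'k) laurent)" where
  "cech_diff c = (\<lambda>T. \<Sum>t\<in>T. (-1) ^ cech_pos T t * c (T - {t}))"

definition cech_cocycles ::
    "('n::{finite,linorder}, 'm::{finite,linorder}, 'k::comm_ring_1) bipoly set \<Rightarrow> nat \<Rightarrow> int \<times> int \<Rightarrow>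
      (('n \<times> 'm) set \<Rightarrow> ('n, 'm, 'k) laurent) set" where
  "cech_cocycles I p d = {c \<in> cech_cochains I p d. cech_diff c = (\<lambda>T. 0)}"

fun cech_coboundaries ::
    "('n::{finite,linorder}, 'm::{finite,linorder}, 'k::comm_ring_1) bipoly set \<Rightarrow> nat \<Rightarrow> int \<times> int \<Rightarrow>
      (('n \<times> 'm) set \<Rightarrow> ('n, 'm, 'k) laurent) set" where
  "cech_coboundaries I 0 d = {\<lambda>T. 0}"
| "cech_coboundaries I (Suc p) d = cech_diff ` cech_cochains I p d"

text \<open>The underlying set of the quotient group of cocycles by coboundaries; the group is zero iff
  this set is a singleton.\<close>

definition local_cohomology ::
    "('n::{finite,linorder}, 'm::{finite,linorder}, 'k::comm_ring_1) bipoly set \<Rightarrow> nat \<Rightarrow> int \<times> int \<Rightarrow>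
      (('n \<times> 'm) set \<Rightarrow> ('n, 'm, 'k) laurent) set set" where
  "local_cohomology I p d =
    cech_cocycles I p d //
      {(c, c'). c \<in> cech_cocycles I p d \<and> c' \<in> cech_cocycles I p d \<and>
                (\<lambda>T. c T - c' T) \<in> cech_coboundaries I p d}"

definition regularity ::
    "('n::{finite,linorder}, 'm::{finite,linorder}, 'k::comm_ring_1) bipoly set \<Rightarrow> (int \<times> int) set" where
  "regularity I =
    {(a, b). \<forall>i\<ge>1. \<forall>lx ly :: nat. lx + ly = i - 1 \<longrightarrow>
       (\<forall>a' b'. a - int lx \<le> a' \<and> b - int ly \<le> b' \<longrightarrow> is_singleton (local_cohomology I i (a', b')))}"


section \<open>Initial ideals\<close>

text \<open>Degree reverse lexicographical order in which the first variable is the smallest.\<close>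

definition drl_less :: "('v::{finite,linorder} \<Rightarrow>\<^sub>0 nat) \<Rightarrow> ('v \<Rightarrow>\<^sub>0 nat) \<Rightarrow> bool" where
  "drl_less e e' \<longleftrightarrow>
    (let deg = (\<lambda>e. \<Sum>v\<in>UNIV. Poly_Mapping.lookup e v) in
      deg e < deg e' \<or>
      deg e = deg e' \<and>
        (\<exists>v. (\<forall>w<v. Poly_Mapping.lookup e w = Poly_Mapping.lookup e' w) \<and>
             Poly_Mapping.lookup e' v < Poly_Mapping.lookup e v))"

definition lead_expo :: "(('v::{finite,linorder} \<Rightarrow>\<^sub>0 nat) \<Rightarrow>\<^sub>0 'k::zero) \<Rightarrow> ('v \<Rightarrow>\<^sub>0 nat)" where
  "lead_expo f =
    (THE e. e \<in> Poly_Mapping.keys f \<and> (\<forall>e'\<in>Poly_Mapping.keys f. e' \<noteq> e \<longrightarrow> drl_less e' e))"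

definition initial_ideal ::
    "(('v::{finite,linorder} \<Rightarrow>\<^sub>0 nat) \<Rightarrow>\<^sub>0 'k::comm_ring_1) set \<Rightarrow> (('v \<Rightarrow>\<^sub>0 nat) \<Rightarrow>\<^sub>0 'k) set" where
  "initial_ideal I = ring_ideal.span {monom (lead_expo f) | f. f \<in> I \<and> f \<noteq> 0}"

definition monomial_ideal :: "(('v \<Rightarrow>\<^sub>0 nat) \<Rightarrow>\<^sub>0 'k::comm_ring_1) set \<Rightarrow> bool" where
  "monomial_ideal J \<longleftrightarrow> (\<exists>G. J = ring_ideal.span (monom ` G))"

text \<open>A minimal generator is (the exponent of) an element of an inclusion-minimal set of monomial
  generators.\<close>

definition minimal_generator :: "(('v \<Rightarrow>\<^sub>0 nat) \<Rightarrow>\<^sub>0 'k::comm_ring_1) set \<Rightarrow> ('v \<Rightarrow>\<^sub>0 nat) \<Rightarrow> bool" where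
  "minimal_generator J e \<longleftrightarrow>
    (\<exists>G. e \<in> G \<and> ring_ideal.span (monom ` G) = J \<and>
         (\<forall>G'. G' \<subset> G \<longrightarrow> ring_ideal.span (monom ` G') \<noteq> J))"


section \<open>Generic coordinates\<close>

fun coordinate_change ::
    "('k::comm_ring_1^'n^'n) \<times> ('k^'m^'m) \<Rightarrow> ('n::finite, 'm::finite) var \<Rightarrow> ('n, 'm, 'k) bipoly" where
  "coordinate_change u (X i) = (\<Sum>j\<in>UNIV. const_poly (fst u $ i $ j) * var_poly (X j))"
| "coordinate_change u (Y i) = (\<Sum>j\<in>UNIV. const_poly (snd u $ i $ j) * var_poly (Y j))"

definition gl_act ::
    "('k::comm_ring_1^'n^'n) \<times> ('k^'m^'m) \<Rightarrow> ('n::finite, 'm::finite, 'k) bipoly \<Rightarrow> ('n, 'm, 'k) bipoly" where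
  "gl_act u = poly_eval const_poly (coordinate_change u)"

definition GL2 :: "(('k::field^'n^'n) \<times> ('k^'m^'m)) set" where
  "GL2 = {u. invertible (fst u) \<and> invertible (snd u)}"

fun entry :: "('k^'n^'n) \<times> ('k^'m^'m) \<Rightarrow> ('n::finite \<times> 'n) + ('m::finite \<times> 'm) \<Rightarrow> 'k" where
  "entry u (Inl (i, j)) = fst u $ i $ j"
| "entry u (Inr (i, j)) = snd u $ i $ j"

text \<open>The topology on the product of general linear groups is the subspace topology of the Zariski
  topology on the affine space of pairs of matrices: an open set is the locus where some member of a
  family of polynomials in the matrix entries does not vanish.\<close>

definition zariski_open :: "(('k::field^'n^'n) \<times> ('k^'m^'m)) set \<Rightarrow> bool" where
  "zariski_open U \<longleftrightarrow>
    (\<exists>F :: ((('n \<times> 'n) + ('m \<times> 'm) \<Rightarrow>\<^sub>0 nat) \<Rightarrow>\<^sub>0 'k) set.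
       U = {u \<in> GL2. \<exists>f\<in>F. poly_eval id (entry u) f \<noteq> 0})"

text \<open>\<open>is_bigin J I\<close>: the bigeneric initial ideal of \<open>I\<close> is \<open>J\<close>. There is at most one such \<open>J\<close> over an
  infinite field, because nonempty open sets then intersect.\<close>

definition is_bigin ::
    "('n::{finite,linorder}, 'm::{finite,linorder}, 'k::field) bipoly set \<Rightarrow> ('n, 'm, 'k) bipoly set \<Rightarrow> bool" where
  "is_bigin J I \<longleftrightarrow>
    monomial_ideal J \<and>
    (\<exists>U. zariski_open U \<and> U \<noteq> {} \<and> (\<forall>u\<in>U. initial_ideal (gl_act u ` I) = J))"

end

theory Submission
  imports Defs
begin

text \<open>
  Write \<open>S\<close> for the polynomial ring. The regularity of \<open>(a, b)\<close> enters twice. Since the zero locus of \<open>I\<close> is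
  empty, \<open>S/I\<close> is torsion for the irrelevant ideal, hence embeds into the first local cohomology of \<open>I\<close>,
  and the vanishing of the latter in bidegree \<open>(a, b)\<close> says that \<open>I\<close> contains every form of that bidegree
  (\<open>monom_in_ideal_if_H1_zero\<close>).

  A form of larger bidegree is then a combination of multiples of these forms, provided that \<open>a\<close> and \<open>b\<close>
  are nonnegative. They are: the top cohomology of one projective space with values in a sufficiently
  negative line bundle, pulled back to the product, gives classes in the local cohomology of \<open>S\<close>, which agrees with that of \<open>I\<close> to the extent needed because \<open>I\<close> and \<open>S\<close> have
  the same localization at every \<open>x_i y_j\<close>. If \<open>a < 0\<close> then such a nonzero class for the first factor lies
  in bidegree \<open>(a - n, max b 0)\<close> of the cohomology in degree \<open>n + 1\<close>, which the regularity
  condition with \<open>\<lambda>_x = n\<close> and \<open>\<lambda>_y = 0\<close> forbids (\<open>pulled_back_top_class\<close>, \<open>regularity_nonneg\<close>).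

  Both cocycles are instances of one construction: the cochain obtained by pulling back a single Laurent
  monomial along a map \<open>\<phi>\<close> from the index pairs \<open>(i, j)\<close> to the indices of a coarser cover. The map \<open>\<phi>\<close> is
  constant in the first case and a projection in the second (\<open>pulled_back_cochain_cocycle\<close>).

  Finally, a linear change of coordinates is an automorphism of \<open>S\<close> that preserves bidegrees, so
  \<open>u \<circ> I\<close>, and with it the initial ideal, also contains all monomials of bidegree \<open>(a, b)\<close>
  (\<open>monom_in_coordinate_change\<close>). A monomial of larger bidegree is a proper multiple of one of
  these, so it is redundant among the generators (\<open>proper_multiple_not_minimal_generator\<close>).
\<close>

section \<open>Monomials\<close>

lemma poly_mapping_sum_single:
  "(\<Sum>k\<in>Poly_Mapping.keys f. Poly_Mapping.single k (Poly_Mapping.lookup f k)) = f"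
proof (rule poly_mapping_eqI)
  fix k
  have "(\<Sum>x\<in>Poly_Mapping.keys f.
          Poly_Mapping.lookup (Poly_Mapping.single x (Poly_Mapping.lookup f x)) k)
      = (\<Sum>x\<in>Poly_Mapping.keys f. if x = k then Poly_Mapping.lookup f k else 0)"
    by (intro sum.cong) (auto simp: lookup_single)
  then show "Poly_Mapping.lookup
      (\<Sum>x\<in>Poly_Mapping.keys f. Poly_Mapping.single x (Poly_Mapping.lookup f x)) k
    = Poly_Mapping.lookup f k"
    by (simp add: lookup_sum in_keys_iff)
qed

lemma monom_add: "(monom (e + f) :: _ \<Rightarrow>\<^sub>0 'k::comm_ring_1) = monom e * monom f"
  by (simp add: monom_def mult_single)

lemma monom_0: "(monom 0 :: _ \<Rightarrow>\<^sub>0 'k::comm_ring_1) = 1"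
  by (simp add: monom_def)

lemma keys_monom [simp]: "Poly_Mapping.keys (monom e :: _ \<Rightarrow>\<^sub>0 'k::comm_ring_1) = {e}"
  by (simp add: monom_def)

lemma monom_neq_0 [simp]: "(monom e :: _ \<Rightarrow>\<^sub>0 'k::comm_ring_1) \<noteq> 0"
  using keys_monom[of e, where 'k='k] by force

lemma const_poly_mult_monom: "const_poly c * monom e = (Poly_Mapping.single e c :: _ \<Rightarrow>\<^sub>0 'k::comm_ring_1)"
  by (simp add: const_poly_def monom_def mult_single)

lemma const_poly_mult: "const_poly (c * d :: 'k::comm_ring_1) = const_poly c * const_poly d"
  by (simp add: const_poly_def mult_single)

lemma expo_le_split:
  fixes e f :: "'v \<Rightarrow>\<^sub>0 nat"
  assumes "\<And>v. Poly_Mapping.lookup e v \<le> Poly_Mapping.lookup f v"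
  shows "f = e + (f - e)"
  using assms by (intro poly_mapping_eqI) (simp add: lookup_add lookup_minus)

lemma expo_induct [case_names zero add_var]:
  assumes "P 0" and step: "\<And>e v. P e \<Longrightarrow> P (Poly_Mapping.single v (1::nat) + e)"
  shows "P e"
proof (induction "\<Sum>v\<in>Poly_Mapping.keys e. Poly_Mapping.lookup e v" arbitrary: e)
  case 0
  then have "e = 0"
    by (intro poly_mapping_eqI) (metis finite_keys in_keys_iff lookup_zero sum_eq_0_iff)
  then show ?case using assms(1) by simp
next
  case (Suc k)
  then obtain v where v: "v \<in> Poly_Mapping.keys e"
    by fastforce
  define f where "f = e - Poly_Mapping.single v 1"
  have e: "e = Poly_Mapping.single v 1 + f"
    unfolding f_def using v
    by (intro expo_le_split) (auto simp: lookup_single when_def in_keys_iff)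
  have "(\<Sum>w\<in>Poly_Mapping.keys f. Poly_Mapping.lookup f w)
      = (\<Sum>w\<in>Poly_Mapping.keys e. Poly_Mapping.lookup f w)"
    by (rule sum.mono_neutral_left)
       (auto simp: e lookup_add in_keys_iff)
  moreover have "(\<Sum>w\<in>Poly_Mapping.keys e. Poly_Mapping.lookup e w)
      = 1 + (\<Sum>w\<in>Poly_Mapping.keys e. Poly_Mapping.lookup f w)"
  proof -
    have "(\<Sum>w\<in>Poly_Mapping.keys e. Poly_Mapping.lookup e w)
      = (\<Sum>w\<in>Poly_Mapping.keys e. (if w = v then 1 else 0) + Poly_Mapping.lookup f w)"
      by (rule sum.cong) (auto simp: e lookup_add lookup_single)
    then show ?thesis using v by (simp add: sum.distrib)
  qed
  ultimately have "P f" using Suc by (metis add_left_cancel plus_1_eq_Suc)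
  then show ?case using step e by metis
qed

lemma bidegree_0 [simp]: "bidegree 0 = 0"
  by (simp add: bidegree_def zero_prod_def)

lemma bidegree_add: "bidegree (e + f) = bidegree e + bidegree f"
  by (simp add: bidegree_def lookup_add sum.distrib)

lemma bidegree_single:
  "bidegree (Poly_Mapping.single (X i) c) = (c, 0)" "bidegree (Poly_Mapping.single (Y j) c) = (0, c)"
  by (simp_all add: bidegree_def lookup_single when_def)

lemma sum_dominated_nat:
  fixes f :: "'a \<Rightarrow> nat"
  assumes "finite A" "k \<le> sum f A"
  obtains g where "\<And>x. g x \<le> f x" "sum g A = k"
proof -
  have "\<exists>g. (\<forall>x. g x \<le> f x) \<and> sum g A = k"
    using assms
  proof (induction A arbitrary: k rule: finite_induct)
    case empty
    then show ?case by auto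
  next
    case (insert y A)
    define l where "l = min k (f y)"
    have "k - l \<le> sum f A" using insert by (auto simp: l_def)
    then obtain g where g: "\<forall>x. g x \<le> f x" "sum g A = k - l" using insert.IH by blast
    have "(\<Sum>x\<in>A. (g(y := l)) x) = sum g A" using insert.hyps by (intro sum.cong) auto
    then have "sum (g(y := l)) (insert y A) = k"
      using insert.hyps g by (simp add: l_def)
    then show ?case using g by (intro exI[of _ "g(y := l)"]) (auto simp: l_def)
  qed
  then show ?thesis using that by blast
qed

lemma monomial_divisor_of_bidegree:
  fixes e :: "('n::finite, 'm::finite) expo"
  assumes "a \<le> fst (bidegree e)" "b \<le> snd (bidegree e)"
  obtains f where "\<And>v. Poly_Mapping.lookup f v \<le> Poly_Mapping.lookup e v" "bidegree f = (a, b)"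
proof -
  obtain g where g: "\<And>i. g i \<le> Poly_Mapping.lookup e (X i)" "sum g UNIV = a"
    using sum_dominated_nat[of UNIV a "\<lambda>i. Poly_Mapping.lookup e (X i)"] assms
    by (auto simp: bidegree_def)
  obtain h where h: "\<And>j. h j \<le> Poly_Mapping.lookup e (Y j)" "sum h UNIV = b"
    using sum_dominated_nat[of UNIV b "\<lambda>j. Poly_Mapping.lookup e (Y j)"] assms
    by (auto simp: bidegree_def)
  define f where "f = Abs_poly_mapping (case_var g h)"
  have "Poly_Mapping.lookup f v \<le> Poly_Mapping.lookup e v" for v
    using g h by (cases v) (auto simp: f_def)
  moreover have "bidegree f = (a, b)" using g h by (simp add: bidegree_def f_def)
  ultimately show ?thesis using that by blast
qed


section \<open>Minimal generators of monomial ideals\<close>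

lemma keys_of_monomial_ideal:
  assumes "p \<in> ring_ideal.span (monom ` G :: (('v \<Rightarrow>\<^sub>0 nat) \<Rightarrow>\<^sub>0 'k::comm_ring_1) set)"
    and "e \<in> Poly_Mapping.keys p"
  shows "\<exists>g\<in>G. \<exists>f. e = f + g"
  using assms
proof (induction arbitrary: e rule: ring_ideal.span_induct_alt)
  case base
  then show ?case by simp
next
  case (step c x y)
  from step.hyps obtain g where g: "g \<in> G" "x = monom g" by blast
  have "e \<in> Poly_Mapping.keys (c * x) \<or> e \<in> Poly_Mapping.keys y"
    using step.prems keys_add[of "c * x" y] by blast
  then show ?case
  proof
    assume "e \<in> Poly_Mapping.keys (c * x)"
    then show ?thesis using keys_mult[of c x] g by fastforce
  next
    assume "e \<in> Poly_Mapping.keys y"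
    then show ?thesis using step.IH by blast
  qed
qed

text \<open>Any set of monomial generators contains a divisor of \<open>f\<close>. This divisor differs from the proper
  multiple \<open>f + g\<close>, which is therefore redundant in that set.\<close>

lemma proper_multiple_not_minimal_generator:
  fixes J :: "(('v \<Rightarrow>\<^sub>0 nat) \<Rightarrow>\<^sub>0 'k::comm_ring_1) set"
  assumes "monom f \<in> J" and "g \<noteq> 0"
  shows "\<not> minimal_generator J (f + g)"
proof
  assume "minimal_generator J (f + g)"
  then obtain G where G: "f + g \<in> G" "ring_ideal.span (monom ` G) = J"
    and min: "\<And>G'. G' \<subset> G \<Longrightarrow> ring_ideal.span (monom ` G') \<noteq> J"
    unfolding minimal_generator_def by blast
  obtain h k where h: "h \<in> G" "f = k + h"
    using keys_of_monomial_ideal[of "monom f" G f] assms(1) G(2) by auto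
  have "h \<noteq> f + g"
  proof
    assume "h = f + g"
    then have "f = f + (k + g)" using h by (metis add.assoc add.commute)
    then have "k + g = 0" by (metis add_left_cancel add.right_neutral)
    then have "g = 0"
      by (intro poly_mapping_eqI) (metis add_is_0 lookup_add lookup_zero)
    with assms(2) show False ..
  qed
  let ?H = "G - {f + g}"
  have "monom h \<in> monom ` ?H" using h \<open>h \<noteq> f + g\<close> by blast
  then have "monom (k + g) * monom h \<in> ring_ideal.span (monom ` ?H :: (_ \<Rightarrow>\<^sub>0 'k) set)"
    by (intro ring_ideal.span_scale ring_ideal.span_base)
  moreover have "monom (k + g) * monom h = (monom (f + g) :: _ \<Rightarrow>\<^sub>0 'k)"
    by (simp add: h(2) ac_simps flip: monom_add)
  ultimately have "monom ` G \<subseteq> ring_ideal.span (monom ` ?H :: (_ \<Rightarrow>\<^sub>0 'k) set)"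
    by (auto intro: ring_ideal.span_base)
  then have "ring_ideal.span (monom ` G) \<subseteq> ring_ideal.span (monom ` ?H :: (_ \<Rightarrow>\<^sub>0 'k) set)"
    by (simp add: ring_ideal.span_minimal)
  moreover have "ring_ideal.span (monom ` ?H) \<subseteq> ring_ideal.span (monom ` G :: (_ \<Rightarrow>\<^sub>0 'k) set)"
    by (intro ring_ideal.span_mono) auto
  ultimately show False using min[of ?H] G by blast
qed

lemma lead_expo_monom: "lead_expo (monom e :: _ \<Rightarrow>\<^sub>0 'k::comm_ring_1) = e"
  unfolding lead_expo_def by (rule the_equality) auto


section \<open>Linear changes of coordinates\<close>

lemma poly_eval_superset:
  assumes "finite A" "Poly_Mapping.keys p \<subseteq> A" "h 0 = 0"
  shows "poly_eval h s p = (\<Sum>e\<in>A. h (Poly_Mapping.lookup p e) * (\<Prod>v\<in>UNIV. s v ^ Poly_Mapping.lookup e v))"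
  unfolding poly_eval_def
  by (rule sum.mono_neutral_left) (use assms in \<open>auto simp: in_keys_iff\<close>)

lemma gl_act_add: "gl_act u (p + q) = gl_act u p + gl_act u q"
proof -
  let ?A = "Poly_Mapping.keys p \<union> Poly_Mapping.keys q"
  have "Poly_Mapping.keys (p + q) \<subseteq> ?A" by (rule keys_add)
  then show ?thesis
    unfolding gl_act_def
    by (simp add: poly_eval_superset[of ?A] lookup_add const_poly_def single_add distrib_right sum.distrib)
qed

lemma gl_act_0 [simp]: "gl_act u 0 = 0"
  by (simp add: gl_act_def poly_eval_def)

lemma gl_act_sum: "gl_act u (sum f A) = (\<Sum>x\<in>A. gl_act u (f x))"
  by (induction A rule: infinite_finite_induct) (simp_all add: gl_act_add)

lemma gl_act_single:
  "gl_act u (Poly_Mapping.single e c) = const_poly c * (\<Prod>v\<in>UNIV. coordinate_change u v ^ Poly_Mapping.lookup e v)"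
  by (simp add: gl_act_def poly_eval_superset[of "{e}"] const_poly_def)

lemma gl_act_mult: "gl_act u (p * q) = gl_act u p * gl_act u q"
proof -
  let ?s = "\<lambda>p e. Poly_Mapping.single e (Poly_Mapping.lookup p e)"
  have single: "gl_act u (?s p e * ?s q f) = gl_act u (?s p e) * gl_act u (?s q f)" for e f
    by (simp only: gl_act_single mult_single lookup_add power_add prod.distrib const_poly_mult mult_ac)
  have "gl_act u (p * q)
      = gl_act u ((\<Sum>e\<in>Poly_Mapping.keys p. ?s p e) * (\<Sum>f\<in>Poly_Mapping.keys q. ?s q f))"
    by (simp add: poly_mapping_sum_single)
  also have "\<dots> = gl_act u (\<Sum>e\<in>Poly_Mapping.keys p. ?s p e) * gl_act u (\<Sum>f\<in>Poly_Mapping.keys q. ?s q f)"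
    by (simp add: sum_product gl_act_sum single)
  finally show ?thesis by (simp add: poly_mapping_sum_single)
qed

lemma gl_act_1 [simp]: "gl_act u 1 = 1"
  using gl_act_single[of u 0 1] by (simp add: const_poly_def)

lemma gl_act_const_poly: "gl_act u (const_poly c) = const_poly c"
  using gl_act_single[of u 0 c] by (simp add: const_poly_def)

lemma gl_act_var_poly: "gl_act u (var_poly v) = coordinate_change u v"
proof -
  have "(\<Prod>w\<in>UNIV. coordinate_change u w ^ Poly_Mapping.lookup (Poly_Mapping.single v 1) w)
      = (\<Prod>w\<in>UNIV. if w = v then coordinate_change u v else 1)"
    by (rule prod.cong) (auto simp: lookup_single when_def)
  then show ?thesis by (simp add: var_poly_def monom_def gl_act_single const_poly_def)
qed

lemma const_poly_sum: "const_poly (sum f A) = (\<Sum>x\<in>A. const_poly (f x :: 'k::comm_ring_1))"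
  by (induction A rule: infinite_finite_induct) (simp_all add: const_poly_def single_add)

lemma linear_forms_compose:
  fixes A B :: "'k::comm_ring_1^'n^'n"
  assumes "A ** B = mat 1"
  shows "(\<Sum>j\<in>UNIV. const_poly (A $ i $ j) * (\<Sum>k\<in>UNIV. const_poly (B $ j $ k) * z k)) = z i"
proof -
  have "(\<Sum>j\<in>UNIV. const_poly (A $ i $ j) * (\<Sum>k\<in>UNIV. const_poly (B $ j $ k) * z k))
      = (\<Sum>k\<in>UNIV. const_poly (\<Sum>j\<in>UNIV. A $ i $ j * B $ j $ k) * z k)"
    unfolding const_poly_sum sum_distrib_left sum_distrib_right
    by (subst sum.swap) (simp add: const_poly_def mult_single flip: mult.assoc)
  also have "\<dots> = (\<Sum>k\<in>UNIV. const_poly (mat 1 $ i $ k) * z k)"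
    unfolding assms[symmetric] by (simp add: matrix_matrix_mult_def)
  also have "\<dots> = (\<Sum>k\<in>UNIV. if k = i then z i else 0)"
    by (rule sum.cong) (auto simp: mat_def const_poly_def)
  finally show ?thesis by simp
qed

lemma gl_act_compose_var_poly:
  assumes "fst u' ** fst u = mat 1" "snd u' ** snd u = mat 1"
  shows "gl_act u (gl_act u' (var_poly v)) = var_poly v"
  by (cases v)
     (simp_all add: gl_act_var_poly gl_act_sum gl_act_mult gl_act_const_poly linear_forms_compose assms)

lemma bihomogeneous_of_mult:
  fixes p q :: "('n::finite, 'm::finite, 'k::comm_ring_1) bipoly"
  assumes "bihomogeneous_of d p" "bihomogeneous_of d' q"
  shows "bihomogeneous_of (d + d') (p * q)"
  using assms keys_mult[of p q] by (fastforce simp: bihomogeneous_of_def bidegree_add)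

lemma bihomogeneous_of_linear_form:
  fixes w :: "'i \<Rightarrow> ('n::finite, 'm::finite) var" and c :: "'i \<Rightarrow> 'k::comm_ring_1"
  assumes "\<And>j. bidegree (Poly_Mapping.single (w j) (1::nat)) = d"
  shows "bihomogeneous_of d (\<Sum>j\<in>A. const_poly (c j) * var_poly (w j))"
  unfolding bihomogeneous_of_def
proof
  fix e assume "e \<in> Poly_Mapping.keys (\<Sum>j\<in>A. const_poly (c j) * var_poly (w j))"
  then have "(\<Sum>j\<in>A. Poly_Mapping.lookup (const_poly (c j) * var_poly (w j)) e) \<noteq> 0"
    by (simp add: in_keys_iff lookup_sum)
  then obtain j where "Poly_Mapping.lookup (const_poly (c j) * var_poly (w j)) e \<noteq> 0"
    by (rule sum.not_neutral_contains_not_neutral)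
  then have "e = Poly_Mapping.single (w j) 1"
    by (auto simp: var_poly_def const_poly_mult_monom lookup_single when_def split: if_splits)
  then show "bidegree e = d" using assms by simp
qed

lemma bihomogeneous_of_gl_act_var_poly:
  "bihomogeneous_of (bidegree (Poly_Mapping.single v 1)) (gl_act u (var_poly v))"
  by (cases v) (simp_all add: gl_act_var_poly bihomogeneous_of_linear_form bidegree_single del: One_nat_def)

text \<open>Since linear substitutions preserve bidegrees and are invertible, an ideal that contains every
  form of a bidegree still does so after a change of coordinates.\<close>

lemma monom_in_coordinate_change:
  fixes I :: "('n::finite, 'm::finite, 'k::field) bipoly set"
  assumes u: "u \<in> GL2" and sub: "ring_ideal.subspace I"
    and full: "\<And>f. bidegree f = bidegree e \<Longrightarrow> monom f \<in> I"
  shows "monom e \<in> gl_act u ` I"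
proof -
  obtain A B where "A ** fst u = mat 1" "B ** snd u = mat 1"
    using u unfolding GL2_def invertible_def by blast
  define u' where "u' = (A, B)"
  have u': "fst u' ** fst u = mat 1" "snd u' ** snd u = mat 1"
    by (simp_all add: u'_def \<open>A ** fst u = mat 1\<close> \<open>B ** snd u = mat 1\<close>)
  have *: "bihomogeneous_of (bidegree f) (gl_act u' (monom f :: _ \<Rightarrow>\<^sub>0 'k))
      \<and> gl_act u (gl_act u' (monom f)) = (monom f :: _ \<Rightarrow>\<^sub>0 'k)" for f
  proof (induction f rule: expo_induct)
    case zero
    then show ?case by (simp add: monom_0 bihomogeneous_of_def)
  next
    case (add_var f v)
    have m: "(monom (Poly_Mapping.single v 1 + f) :: _ \<Rightarrow>\<^sub>0 'k) = var_poly v * monom f"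
      by (simp only: monom_add var_poly_def)
    show ?case
      unfolding m bidegree_add gl_act_mult
      using add_var bihomogeneous_of_mult bihomogeneous_of_gl_act_var_poly
        gl_act_compose_var_poly[OF u'] by metis
  qed
  define p where "p = gl_act u' (monom e :: _ \<Rightarrow>\<^sub>0 'k)"
  have "const_poly (Poly_Mapping.lookup p f) * monom f \<in> I" if "f \<in> Poly_Mapping.keys p" for f
    using * that sub full unfolding p_def bihomogeneous_of_def ring_ideal.subspace_def by blast
  then have "(\<Sum>f\<in>Poly_Mapping.keys p. const_poly (Poly_Mapping.lookup p f) * monom f) \<in> I"
    by (rule ring_ideal.subspace_sum[OF sub])
  then have "p \<in> I" by (simp add: const_poly_mult_monom poly_mapping_sum_single)
  moreover have "gl_act u p = monom e" using * by (simp add: p_def)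
  ultimately show ?thesis by (metis image_eqI)
qed


section \<open>Localizations of an ideal with empty zero locus\<close>

definition cech_expo :: "('n \<times> 'm) set \<Rightarrow> ('n, 'm) expo" where
  "cech_expo T = (\<Sum>(i, j)\<in>T. Poly_Mapping.single (X i) 1 + Poly_Mapping.single (Y j) 1)"

lemma monom_sum: "(monom (sum f A) :: _ \<Rightarrow>\<^sub>0 'k::comm_ring_1) = (\<Prod>x\<in>A. monom (f x))"
  by (induction A rule: infinite_finite_induct) (simp_all add: monom_0 monom_add)

lemma cech_monomial_eq: "(cech_monomial T :: ('n, 'm, 'k::comm_ring_1) bipoly) = monom (cech_expo T)"
  by (simp add: cech_monomial_def cech_expo_def monom_sum var_poly_def case_prod_unfold monom_add)

lemma lookup_cech_expo_X:
  fixes T :: "('n::finite \<times> 'm::finite) set"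
  shows "Poly_Mapping.lookup (cech_expo T) (X i) > 0 \<longleftrightarrow> i \<in> fst ` T"
  by (simp add: cech_expo_def lookup_sum lookup_add lookup_single case_prod_unfold when_def
      zero_less_iff_neq_zero del: neq0_conv) force

lemma lookup_cech_expo_Y:
  fixes T :: "('n::finite \<times> 'm::finite) set"
  shows "Poly_Mapping.lookup (cech_expo T) (Y j) > 0 \<longleftrightarrow> j \<in> snd ` T"
  by (simp add: cech_expo_def lookup_sum lookup_add lookup_single case_prod_unfold when_def
      zero_less_iff_neq_zero del: neq0_conv) force

lemma lookup_to_int_expo [simp]:
  "Poly_Mapping.lookup (to_int_expo e) v = int (Poly_Mapping.lookup e v)"
  by (simp add: to_int_expo_def Poly_Mapping.map.rep_eq when_def)

lemma to_int_expo_add: "to_int_expo (e + f) = to_int_expo e + to_int_expo f"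
  by (rule poly_mapping_eqI) (simp add: lookup_add)

lemma to_int_expo_0 [simp]: "to_int_expo 0 = 0"
  by (rule poly_mapping_eqI) simp

lemma to_int_expo_inject [simp]: "to_int_expo e = to_int_expo f \<longleftrightarrow> e = f"
  by (auto simp: poly_mapping_eq_iff fun_eq_iff)

lemma nonneg_expo_is_to_int_expo:
  assumes "\<And>v. 0 \<le> Poly_Mapping.lookup \<gamma> (v :: ('n::finite, 'm::finite) var)"
  obtains e where "\<gamma> = to_int_expo e"
  using assms by (intro that[of "Abs_poly_mapping (\<lambda>v. nat (Poly_Mapping.lookup \<gamma> v))"] poly_mapping_eqI) simp

lemma bidegree_to_int_expo: "bidegree (to_int_expo e) = map_prod int int (bidegree e)"
  by (simp add: bidegree_def)

lemma to_laurent_single: "to_laurent (Poly_Mapping.single e c) = Poly_Mapping.single (to_int_expo e) c"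
  by (cases "c = 0") (simp_all add: to_laurent_def)

lemma lookup_to_laurent:
  "Poly_Mapping.lookup (to_laurent p) (to_int_expo e) = Poly_Mapping.lookup p e"
proof -
  have "Poly_Mapping.lookup (to_laurent p) (to_int_expo e)
      = (\<Sum>f\<in>Poly_Mapping.keys p. if f = e then Poly_Mapping.lookup p e else 0)"
    unfolding to_laurent_def lookup_sum by (rule sum.cong) (auto simp: lookup_single)
  then show ?thesis by (simp add: in_keys_iff)
qed

lemma keys_to_laurent: "Poly_Mapping.keys (to_laurent p) \<subseteq> range to_int_expo"
proof
  fix \<gamma> assume "\<gamma> \<in> Poly_Mapping.keys (to_laurent p)"
  then have "(\<Sum>e\<in>Poly_Mapping.keys p.
      Poly_Mapping.lookup (Poly_Mapping.single (to_int_expo e) (Poly_Mapping.lookup p e)) \<gamma>) \<noteq> 0"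
    by (simp add: to_laurent_def in_keys_iff lookup_sum)
  then obtain e where
    "Poly_Mapping.lookup (Poly_Mapping.single (to_int_expo e) (Poly_Mapping.lookup p e)) \<gamma> \<noteq> 0"
    by (rule sum.not_neutral_contains_not_neutral)
  then have "\<gamma> = to_int_expo e" by (metis lookup_single_not_eq)
  then show "\<gamma> \<in> range to_int_expo" by blast
qed

lemma to_laurent_inject: "to_laurent p = to_laurent q \<Longrightarrow> p = q"
  by (rule poly_mapping_eqI) (metis lookup_to_laurent)

lemma monom_power: "(monom e :: _ \<Rightarrow>\<^sub>0 'k::comm_ring_1) ^ N = monom (\<Sum>i<N. e)"
  by (simp add: monom_sum)

lemma to_laurent_monom_power:
  "to_laurent (monom e :: ('n, 'm, 'k::comm_ring_1) bipoly) ^ N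
    = Poly_Mapping.single (to_int_expo (\<Sum>i<N. e)) 1"
  by (induction N)
     (simp_all add: monom_def to_laurent_single mult_single to_int_expo_add add.commute del: sum_constant)

lemma cech_monomial_in_irrelevant_ideal:
  fixes T :: "('n::finite \<times> 'm::finite) set"
  assumes "T \<noteq> {}"
  shows "(cech_monomial T :: ('n, 'm, 'k::comm_ring_1) bipoly) \<in> irrelevant_ideal"
proof -
  let ?f = "\<lambda>(i, j). var_poly (X i) * var_poly (Y j) :: ('n, 'm, 'k) bipoly"
  obtain i j where ij: "(i, j) \<in> T" using assms by auto
  have "cech_monomial T = (\<Prod>t\<in>T - {(i, j)}. ?f t) * ?f (i, j)"
    unfolding cech_monomial_def using prod.remove[OF _ ij, of ?f] by (simp add: mult.commute)
  moreover have "?f (i, j) \<in> irrelevant_ideal"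
    unfolding irrelevant_ideal_def ideal_mult_def
    by (auto intro!: ring_ideal.span_base)
  ultimately show ?thesis
    unfolding irrelevant_ideal_def ideal_mult_def by (simp only: ring_ideal.span_scale)
qed

lemma power_in_ideal_power: "x \<in> A \<Longrightarrow> x ^ t \<in> ideal_power A t"
  by (induction t) (auto simp: ideal_mult_def intro!: ring_ideal.span_base)

text \<open>If \<open>I\<close> contains a power of the irrelevant ideal then \<open>I\<close> and \<open>S\<close> have the same localization at
  \<open>x_i y_j\<close>. Hence a Laurent monomial lies in the localization of \<open>I\<close> as soon as every variable with
  a negative exponent has been inverted.\<close>

lemma single_in_localization:
  fixes I :: "('n::finite, 'm::finite, 'k::comm_ring_1) bipoly set"
  assumes sub: "ring_ideal.subspace I" and pow: "ideal_power irrelevant_ideal t \<subseteq> I"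
    and T: "T \<noteq> {}"
    and \<gamma>: "\<And>v. Poly_Mapping.lookup \<gamma> v < 0 \<Longrightarrow> 0 < Poly_Mapping.lookup (cech_expo T) v"
  shows "Poly_Mapping.single \<gamma> c \<in> localization I (cech_monomial T)"
proof -
  let ?E = "cech_expo T"
  \<comment> \<open>A power of the monomial that clears all denominators of \<open>\<gamma>\<close>.\<close>
  define K where "K = (\<Sum>v\<in>UNIV. nat (- Poly_Mapping.lookup \<gamma> v))"
  have "0 \<le> Poly_Mapping.lookup (to_int_expo (\<Sum>i<K. ?E) + \<gamma>) v" for v
  proof (cases "Poly_Mapping.lookup \<gamma> v < 0")
    case True
    have "nat (- Poly_Mapping.lookup \<gamma> v) \<le> K"
      unfolding K_def by (rule member_le_sum) auto
    also have "K \<le> K * Poly_Mapping.lookup ?E v" using \<gamma>[OF True] by simp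
    finally show ?thesis by (simp add: lookup_add lookup_sum nat_le_iff)
  qed (simp add: lookup_add)
  then obtain e where e: "to_int_expo (\<Sum>i<K. ?E) + \<gamma> = to_int_expo e"
    by (rule nonneg_expo_is_to_int_expo)
  have "(\<Sum>i<t + K. ?E) = (\<Sum>i<t. ?E) + (\<Sum>i<K. ?E)"
    by (rule poly_mapping_eqI) (simp add: lookup_sum lookup_add distrib_right)
  then have "to_laurent (cech_monomial T) ^ (t + K) * Poly_Mapping.single \<gamma> c
      = to_laurent (Poly_Mapping.single ((\<Sum>i<t. ?E) + e) c)"
    unfolding cech_monomial_eq to_laurent_monom_power
    by (simp add: to_laurent_single mult_single to_int_expo_add add.assoc e del: sum_constant)
  moreover have "Poly_Mapping.single ((\<Sum>i<t. ?E) + e) c \<in> I"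
  proof -
    have "cech_monomial T ^ t \<in> I"
      using power_in_ideal_power cech_monomial_in_irrelevant_ideal[OF T] pow by blast
    then have "Poly_Mapping.single e c * cech_monomial T ^ t \<in> I"
      using sub by (simp add: ring_ideal.subspace_def)
    then show ?thesis
      unfolding cech_monomial_eq monom_power
      by (simp add: monom_def mult_single add.commute del: sum_constant)
  qed
  ultimately show ?thesis unfolding localization_def by blast
qed

lemma localization_nonneg:
  fixes I :: "('n::finite, 'm::finite, 'k::comm_ring_1) bipoly set"
  assumes g: "g \<in> localization I (cech_monomial T)" and \<gamma>: "\<gamma> \<in> Poly_Mapping.keys g"
    and v: "Poly_Mapping.lookup (cech_expo T) v = 0"
  shows "0 \<le> Poly_Mapping.lookup \<gamma> v"
proof -
  obtain N p where p: "to_laurent (cech_monomial T) ^ N * g = to_laurent p"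
    using g unfolding localization_def by blast
  define \<epsilon> where "\<epsilon> = to_int_expo (\<Sum>i<N. cech_expo T)"
  have "Poly_Mapping.single (- \<epsilon>) 1 * to_laurent p
      = (Poly_Mapping.single (- \<epsilon>) 1 * Poly_Mapping.single \<epsilon> 1) * g"
    unfolding p[symmetric] cech_monomial_eq to_laurent_monom_power \<epsilon>_def
    by (simp only: mult.assoc)
  then have "g = Poly_Mapping.single (- \<epsilon>) 1 * to_laurent p"
    by (simp add: mult_single)
  then obtain e where "\<gamma> = - \<epsilon> + to_int_expo e"
    using \<gamma> keys_mult[of "Poly_Mapping.single (- \<epsilon>) 1" "to_laurent p"] keys_to_laurent[of p]
    by fastforce
  then show ?thesis by (simp add: lookup_add lookup_minus \<epsilon>_def lookup_sum v)
qed

lemma localization_1: "localization I (cech_monomial {}) = to_laurent ` I"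
proof -
  have "to_laurent (1 :: ('a, 'b, 'c) bipoly) = 1"
    using to_laurent_single[of 0 1] by simp
  then show ?thesis by (simp add: localization_def cech_monomial_def)
qed


section \<open>Cocycles and coboundaries\<close>

lemma cech_diff_0 [simp]: "cech_diff (\<lambda>T. 0) = (\<lambda>T. 0)"
  by (simp add: cech_diff_def)

lemma zero_in_cech_cocycles:
  assumes "ring_ideal.subspace I"
  shows "(\<lambda>T. 0) \<in> cech_cocycles I p d"
proof -
  have "to_laurent 0 \<in> to_laurent ` I"
    using assms by (intro imageI) (simp add: ring_ideal.subspace_def)
  then show ?thesis
    by (simp add: cech_cocycles_def cech_cochains_def localization_def bihomogeneous_of_def
        to_laurent_def)
qed

lemma cocycle_is_coboundary:
  assumes sub: "ring_ideal.subspace I" and "is_singleton (local_cohomology I p d)"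
    and c: "c \<in> cech_cocycles I p d"
  shows "c \<in> cech_coboundaries I p d"
proof -
  let ?R = "{(c, c'). c \<in> cech_cocycles I p d \<and> c' \<in> cech_cocycles I p d \<and>
                (\<lambda>T. c T - c' T) \<in> cech_coboundaries I p d}"
  obtain A where A: "cech_cocycles I p d // ?R = {A}"
    using assms(2) unfolding local_cohomology_def is_singleton_def by blast
  have zero: "(\<lambda>T. 0) \<in> cech_cocycles I p d" by (rule zero_in_cech_cocycles[OF sub])
  have "(\<lambda>T. 0) \<in> cech_coboundaries I p d"
  proof (cases p)
    case (Suc q)
    have "(\<lambda>T. 0) \<in> cech_cochains I q d"
      using zero_in_cech_cocycles[OF sub] by (auto simp: cech_cocycles_def)
    then have "cech_diff (\<lambda>T. 0) \<in> cech_diff ` cech_cochains I q d" by (rule imageI)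
    then show ?thesis by (simp add: Suc)
  qed simp
  then have "(\<lambda>T. 0) \<in> ?R `` {\<lambda>T. 0}" using zero by simp
  moreover have "?R `` {x} = A" if "x \<in> cech_cocycles I p d" for x
    using quotientI[OF that, of ?R] unfolding A by (simp only: singleton_iff)
  ultimately have "(\<lambda>T. 0) \<in> ?R `` {c}" using c zero by (simp only:)
  then show ?thesis by simp
qed

section \<open>Cocycles pulled back from coarser covers\<close>

definition lex_less :: "'a::linorder \<times> 'b::linorder \<Rightarrow> 'a \<times> 'b \<Rightarrow> bool" where
  "lex_less s t \<longleftrightarrow> fst s < fst t \<or> fst s = fst t \<and> snd s < snd t"

lemma lex_less_linear: "s \<noteq> t \<Longrightarrow> lex_less t s \<longleftrightarrow> \<not> lex_less s t"
  by (auto simp: lex_less_def prod_eq_iff)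

lemma not_lex_less_refl [simp]: "\<not> lex_less s s"
  by (simp add: lex_less_def)

definition inversion_factor ::
    "('a::linorder \<times> 'b::linorder \<Rightarrow> 'c::linorder) \<Rightarrow> 'a \<times> 'b \<Rightarrow> 'a \<times> 'b \<Rightarrow> 'r::comm_ring_1" where
  "inversion_factor \<phi> s t = (if lex_less s t \<and> \<phi> t < \<phi> s then - 1 else 1)"

lemma inversion_factor_refl [simp]: "inversion_factor \<phi> s s = 1"
  by (simp add: inversion_factor_def)

text \<open>The sign of the sequence of the values of \<open>\<phi>\<close> on the elements of \<open>T\<close>, listed in lexicographic order.\<close>

definition sequence_sign ::
    "('a::linorder \<times> 'b::linorder \<Rightarrow> 'c::linorder) \<Rightarrow> ('a \<times> 'b) set \<Rightarrow> 'r::comm_ring_1" where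
  "sequence_sign \<phi> T = (\<Prod>s\<in>T. \<Prod>t\<in>T. inversion_factor \<phi> s t)"

lemma sequence_sign_insert:
  assumes "finite R" "s \<notin> R"
  shows "(sequence_sign \<phi> (insert s R) :: 'r::comm_ring_1)
    = sequence_sign \<phi> R * (\<Prod>r\<in>R. inversion_factor \<phi> r s * inversion_factor \<phi> s r)"
  by (simp only: sequence_sign_def prod.insert[OF assms] prod.distrib inversion_factor_refl
      mult_1_left mult_ac)

lemma cech_sign:
  assumes "finite R" "s \<notin> R"
  shows "((-1) ^ cech_pos (insert s R) s :: 'r::comm_ring_1) = (\<Prod>r\<in>R. if lex_less r s then - 1 else 1)"
proof -
  have "{r \<in> insert s R. fst r < fst s \<or> fst r = fst s \<and> snd r < snd s} = {r \<in> R. lex_less r s}"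
    by (auto simp: lex_less_def)
  then show ?thesis
    using assms by (simp add: cech_pos_def prod.If_cases Int_def conj_commute)
qed

text \<open>The sets \<open>R \<union> {s'}\<close> and \<open>R \<union> {s}\<close> give the same sequence of values of \<open>\<phi>\<close>, except that the value
  \<open>\<phi> s = \<phi> s'\<close> has moved past the elements of \<open>R\<close> that lie between \<open>s\<close> and \<open>s'\<close>. The Cech sign changes by the
  same number of transpositions and by one more, that of \<open>s\<close> and \<open>s'\<close>. To count elementwise, let \<open>x\<close> be \<open>s\<close> or
  \<open>s'\<close>: for \<open>r \<in> R\<close> the factor of the pair \<open>r, x\<close> in the sign of the sequence is its factor \<open>l r x\<close> in the
  Cech sign, up to a factor that depends only on whether \<open>\<phi> r < \<phi> s\<close>.\<close>

lemma sequence_sign_cancel: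
  assumes fin: "finite R" and "s \<notin> R" "s' \<notin> R" "s \<noteq> s'" and eq: "\<phi> s = \<phi> s'" and inj: "\<phi> s \<notin> \<phi> ` R"
  shows "(-1) ^ cech_pos (insert s (insert s' R)) s * sequence_sign \<phi> (insert s' R)
       + (-1) ^ cech_pos (insert s (insert s' R)) s' * sequence_sign \<phi> (insert s R) = (0 :: 'r::comm_ring_1)"
proof -
  define l where "l r x = (if lex_less r x then - 1 else 1 :: 'r)" for r x :: "'a \<times> 'b"
  define L where "L x = (\<Prod>r\<in>R. l r x)" for x
  define P where "P = (\<Prod>r\<in>R. if \<phi> r < \<phi> s then - 1 else 1 :: 'r)"
  have factor: "inversion_factor \<phi> r x * inversion_factor \<phi> x r
      = l r x * (if \<phi> r < \<phi> s then - 1 else 1)" if "r \<in> R" "\<phi> x = \<phi> s" for r x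
  proof -
    have "\<phi> r \<noteq> \<phi> x" "r \<noteq> x" using that inj by (metis imageI)+
    then show ?thesis
      using lex_less_linear[of r x] that(2) by (auto simp: inversion_factor_def l_def)
  qed
  have sign: "sequence_sign \<phi> (insert x R) = sequence_sign \<phi> R * (L x * P)"
    if x: "x \<notin> R" "\<phi> x = \<phi> s" for x
  proof -
    have "(\<Prod>r\<in>R. inversion_factor \<phi> r x * inversion_factor \<phi> x r)
        = (\<Prod>r\<in>R. l r x * (if \<phi> r < \<phi> s then - 1 else 1))"
      using factor[OF _ x(2)] by (rule prod.cong[OF refl])
    then show ?thesis
      by (simp only: sequence_sign_insert[OF fin x(1)] L_def P_def prod.distrib)
  qed
  have pos: "(-1) ^ cech_pos (insert x (insert y R)) x = l y x * L x"
    if "x \<notin> insert y R" "y \<notin> R" for x y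
    using that fin cech_sign[of "insert y R" x, where 'r='r]
    by (simp only: finite_insert prod.insert L_def l_def not_False_eq_True simp_thms)
  have first: "(-1) ^ cech_pos (insert s (insert s' R)) s * sequence_sign \<phi> (insert s' R)
      = l s' s * L s * (sequence_sign \<phi> R * (L s' * P))"
    using assms pos[of s s'] sign[OF _ eq[symmetric]] by (simp only: insert_iff simp_thms)
  have second: "(-1) ^ cech_pos (insert s (insert s' R)) s' * sequence_sign \<phi> (insert s R)
      = l s s' * L s' * (sequence_sign \<phi> R * (L s * P))"
    using pos[of s' s] sign[OF \<open>s \<notin> R\<close> refl] \<open>s \<notin> R\<close> \<open>s' \<notin> R\<close> \<open>s \<noteq> s'\<close>[THEN not_sym]
    by (simp only: insert_commute[of s s'] insert_iff simp_thms)
  have "l s' s + l s s' = 0"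
    using lex_less_linear[OF \<open>s \<noteq> s'\<close>] by (simp add: l_def)
  then have "(l s' s + l s s') * (L s * (L s' * (sequence_sign \<phi> R * P))) = 0"
    by (simp only: mult_zero_left)
  then show ?thesis unfolding first second by (simp only: distrib_right distrib_left mult_ac)
qed

lemma sequence_sign_neq_0: "finite T \<Longrightarrow> (sequence_sign \<phi> T :: 'r::field) \<noteq> 0"
  by (simp add: sequence_sign_def inversion_factor_def)

lemma minus_one_power_mult_single:
  "(-1) ^ k * Poly_Mapping.single \<gamma> c = (Poly_Mapping.single \<gamma> ((-1) ^ k * c) :: _ \<Rightarrow>\<^sub>0 'k::comm_ring_1)"
  for \<gamma> :: "'v \<Rightarrow>\<^sub>0 int"
  by (cases "even k") (simp_all add: single_uminus)

text \<open>Let a cover be indexed by the type \<open>'c\<close> such that each set \<open>x_i y_j \<noteq> 0\<close> lies in the member with index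
  \<open>\<phi> (i, j)\<close>. A section \<open>\<gamma>\<close> on the intersection of all members is a cocycle of top degree for this cover, and
  the cochain below is its pullback along \<open>\<phi>\<close>. Cochains record values only on sets of indices, listed lexicographically, so the
  sign by which an alternating cochain changes under reordering becomes explicit.\<close>

definition pulled_back_cochain ::
    "('n::linorder \<times> 'm::linorder \<Rightarrow> 'c::linorder) \<Rightarrow> (('n, 'm) var \<Rightarrow>\<^sub>0 int) \<Rightarrow>
      ('n \<times> 'm) set \<Rightarrow> ('n, 'm, 'k::comm_ring_1) laurent" where
  "pulled_back_cochain \<phi> \<gamma> T =
    (if bij_betw \<phi> T UNIV then Poly_Mapping.single \<gamma> (sequence_sign \<phi> T) else 0)"

text \<open>A summand of the coboundary at \<open>T\<close> is nonzero only if \<open>T\<close> minus one element is mapped bijectively. Then \<open>\<phi>\<close>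
  takes exactly one value twice on \<open>T\<close>, at \<open>s\<close> and \<open>s'\<close> say, and the two summands obtained by removing \<open>s\<close> or \<open>s'\<close>
  cancel.\<close>

lemma pulled_back_cochain_cocycle:
  fixes I :: "('n::{finite,linorder}, 'm::{finite,linorder}, 'k::comm_ring_1) bipoly set"
    and \<phi> :: "'n \<times> 'm \<Rightarrow> 'c::{finite,linorder}"
  assumes sub: "ring_ideal.subspace I" and pow: "ideal_power irrelevant_ideal t \<subseteq> I"
    and neg: "\<And>T v. bij_betw \<phi> T UNIV \<Longrightarrow> Poly_Mapping.lookup \<gamma> v < 0 \<Longrightarrow>
      0 < Poly_Mapping.lookup (cech_expo T) v"
  shows "pulled_back_cochain \<phi> \<gamma> \<in> cech_cocycles I CARD('c) (bidegree \<gamma>)"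
proof -
  let ?c = "pulled_back_cochain \<phi> \<gamma> :: ('n \<times> 'm) set \<Rightarrow> ('n, 'm, 'k) laurent"
  have zero: "0 \<in> localization I f" for f
  proof -
    have "to_laurent 0 \<in> to_laurent ` I"
      using sub by (intro imageI) (simp add: ring_ideal.subspace_def)
    then show ?thesis by (simp add: localization_def to_laurent_def)
  qed
  have "?c \<in> cech_cochains I CARD('c) (bidegree \<gamma>)"
  proof -
    have "Poly_Mapping.single \<gamma> (sequence_sign \<phi> T) \<in> localization I (cech_monomial T)"
      if "bij_betw \<phi> T UNIV" for T
    proof (rule single_in_localization[OF sub pow])
      show "T \<noteq> {}" using that by (auto simp: bij_betw_def)
    qed (use neg that in blast)
    moreover have "card T = CARD('c)" if "bij_betw \<phi> T UNIV" for T
      using that by (rule bij_betw_same_card)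
    ultimately show ?thesis
      by (auto simp: cech_cochains_def pulled_back_cochain_def zero bihomogeneous_of_def)
  qed
  moreover have "cech_diff ?c T = 0" for T
  proof (cases "\<exists>s\<in>T. bij_betw \<phi> (T - {s}) UNIV")
    case False
    then show ?thesis by (simp add: cech_diff_def pulled_back_cochain_def)
  next
    case True
    then obtain s where s: "s \<in> T" "bij_betw \<phi> (T - {s}) UNIV" by blast
    then have "\<phi> s \<in> \<phi> ` (T - {s})" by (simp add: bij_betw_def)
    then obtain s' where s': "s' \<in> T" "s' \<noteq> s" "\<phi> s = \<phi> s'" by auto
    define R where "R = T - {s, s'}"
    have T: "T = insert s (insert s' R)" "s \<notin> R" "s' \<notin> R" using s s' by (auto simp: R_def)
    have Ts: "T - {s} = insert s' R" "T - {s'} = insert s R" using T s'(2) by auto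
    have inj: "inj_on \<phi> (insert s' R)" and onto: "\<phi> ` (insert s' R) = UNIV"
      using s(2) Ts by (simp_all add: bij_betw_def)
    have new: "\<phi> s \<notin> \<phi> ` R" using inj T(3) s'(3) by (auto simp: inj_on_def)
    have bij': "bij_betw \<phi> (T - {s'}) UNIV"
      using inj onto new s'(3) unfolding Ts bij_betw_def by (auto simp: inj_on_def)
    have "?c (T - {r}) = 0" if "r \<in> R" for r
    proof -
      have "{s, s'} \<subseteq> T - {r}" using that T by auto
      then have "\<not> inj_on \<phi> (T - {r})" using s'(2,3) by (auto simp: inj_on_def)
      then show ?thesis by (simp add: pulled_back_cochain_def bij_betw_def)
    qed
    then have "cech_diff ?c T = (\<Sum>r\<in>{s, s'}. (-1) ^ cech_pos T r * ?c (T - {r}))"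
      unfolding cech_diff_def by (intro sum.mono_neutral_right) (use T in auto)
    also have "\<dots> = Poly_Mapping.single \<gamma> ((-1) ^ cech_pos T s * sequence_sign \<phi> (insert s' R)
        + (-1) ^ cech_pos T s' * sequence_sign \<phi> (insert s R))"
      using s s'(2) bij' by (simp add: pulled_back_cochain_def minus_one_power_mult_single single_add flip: Ts)
    also have "\<dots> = 0"
      unfolding T(1) using s' T new by (subst sequence_sign_cancel) auto
    finally show ?thesis .
  qed
  ultimately show ?thesis
    by (simp add: cech_cocycles_def fun_eq_iff)
qed

section \<open>The torsion part of the first local cohomology\<close>

text \<open>A monomial of \<open>S\<close> is a section of the localization of \<open>I\<close> at each \<open>x_i y_j\<close>, so it defines a \<open>1\<close>-cocycle with
  values in \<open>I\<close>. If this is the coboundary of a \<open>0\<close>-cochain, that is of an element of \<open>I\<close>, then this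
  element is the monomial itself.\<close>

lemma monom_in_ideal_if_H1_zero:
  fixes I :: "('n::{finite,linorder}, 'm::{finite,linorder}, 'k::comm_ring_1) bipoly set"
  assumes sub: "ring_ideal.subspace I" and pow: "ideal_power irrelevant_ideal t \<subseteq> I"
    and H1: "is_singleton (local_cohomology I 1 (map_prod int int (bidegree e)))"
  shows "monom e \<in> I"
proof -
  let ?d = "map_prod int int (bidegree e)"
  define g :: "('n, 'm, 'k) laurent" where "g = to_laurent (monom e)"
  have g: "g = Poly_Mapping.single (to_int_expo e) 1"
    by (simp add: g_def monom_def to_laurent_single)
  \<comment> \<open>The coarser cover is the one by a single open set.\<close>
  define c :: "('n \<times> 'm) set \<Rightarrow> ('n, 'm, 'k) laurent" where
    "c = pulled_back_cochain (\<lambda>_. ()) (to_int_expo e)"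
  have "c \<in> cech_cocycles I CARD(unit) ?d"
    unfolding c_def bidegree_to_int_expo[symmetric]
    by (rule pulled_back_cochain_cocycle[OF sub pow]) simp
  then have "c \<in> cech_coboundaries I (Suc 0) ?d"
    using cocycle_is_coboundary[OF sub H1] by simp
  then obtain c0 where c0: "c0 \<in> cech_cochains I 0 ?d" "c = cech_diff c0" by auto
  obtain s :: "'n \<times> 'm" where True by blast
  have "g = c {s}"
    by (simp add: c_def g pulled_back_cochain_def bij_betw_def sequence_sign_def UNIV_unit)
  also have "\<dots> = cech_diff c0 {s}" by (simp only: c0(2))
  also have "\<dots> = c0 {}"
  proof -
    have "cech_pos {s} s = 0" by (auto simp: cech_pos_def)
    then show ?thesis by (simp add: cech_diff_def)
  qed
  finally have "g \<in> to_laurent ` I"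
    using c0(1) by (auto simp: cech_cochains_def simp flip: localization_1)
  then show ?thesis unfolding g_def using to_laurent_inject by blast
qed


section \<open>A nonzero class in top local cohomology\<close>

text \<open>The intended \<open>\<phi>\<close> is one of the two projections, and \<open>w\<close> lists the variables of the corresponding factor. A
  monomial with a negative exponent in every \<open>w c\<close> represents a nonzero top class for the cover of this
  factor by the sets \<open>w c \<noteq> 0\<close>. Its pullback stays nonzero because a section \<open>\<sigma>\<close> of \<open>\<phi>\<close> restricts it to the original
  class: on the image of \<open>\<sigma>\<close> a coboundary is a sum of terms in each of which some \<open>w c\<close> has not been
  inverted, and no such term contains the monomial.\<close>

lemma pulled_back_top_class:
  fixes I :: "('n::{finite,linorder}, 'm::{finite,linorder}, 'k::field) bipoly set"
    and \<phi> :: "'n \<times> 'm \<Rightarrow> 'c::{finite,linorder}" and w :: "'c \<Rightarrow> ('n, 'm) var"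
  assumes sub: "ring_ideal.subspace I" and pow: "ideal_power irrelevant_ideal t \<subseteq> I"
    and sec: "\<And>c. \<phi> (\<sigma> c) = c"
    and expo: "\<And>T c. 0 < Poly_Mapping.lookup (cech_expo T) (w c) \<longleftrightarrow> c \<in> \<phi> ` T"
    and neg: "\<And>c. Poly_Mapping.lookup \<gamma> (w c) < 0"
    and nonneg: "\<And>v. v \<notin> range w \<Longrightarrow> 0 \<le> Poly_Mapping.lookup \<gamma> v"
  shows "\<not> is_singleton (local_cohomology I CARD('c) (bidegree \<gamma>))"
proof
  assume sing: "is_singleton (local_cohomology I CARD('c) (bidegree \<gamma>))"
  define c :: "('n \<times> 'm) set \<Rightarrow> ('n, 'm, 'k) laurent" where "c = pulled_back_cochain \<phi> \<gamma>"
  have "c \<in> cech_cocycles I CARD('c) (bidegree \<gamma>)"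
    unfolding c_def using expo nonneg
    by (intro pulled_back_cochain_cocycle[OF sub pow]) (metis UNIV_I bij_betw_imp_surj_on not_le rangeE)
  then have cob: "c \<in> cech_coboundaries I CARD('c) (bidegree \<gamma>)"
    by (rule cocycle_is_coboundary[OF sub sing])
  obtain p where p: "CARD('c) = Suc p" using not0_implies_Suc by force
  then obtain c0 where c0: "c0 \<in> cech_cochains I p (bidegree \<gamma>)" "c = cech_diff c0"
    using cob by auto
  let ?T = "range \<sigma>"
  have bij: "bij_betw \<phi> ?T UNIV"
    by (auto simp: bij_betw_def inj_on_def sec image_image)
  have "Poly_Mapping.lookup (c ?T) \<gamma> \<noteq> 0"
    using bij by (simp add: c_def pulled_back_cochain_def sequence_sign_neq_0)
  then have "(\<Sum>s\<in>?T. Poly_Mapping.lookup ((-1) ^ cech_pos ?T s * c0 (?T - {s})) \<gamma>) \<noteq> 0"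
    unfolding c0(2) by (simp add: cech_diff_def lookup_sum)
  then obtain s where s: "s \<in> ?T"
    and "Poly_Mapping.lookup ((-1) ^ cech_pos ?T s * c0 (?T - {s})) \<gamma> \<noteq> 0"
    by (rule sum.not_neutral_contains_not_neutral)
  then have \<gamma>: "\<gamma> \<in> Poly_Mapping.keys (c0 (?T - {s}))"
    by (cases "even (cech_pos ?T s)") (auto simp: in_keys_iff)
  have "card ?T = Suc p" using bij_betw_same_card[OF bij] p by simp
  then have "card (?T - {s}) = p" using s by simp
  then have "c0 (?T - {s}) \<in> localization I (cech_monomial (?T - {s}))"
    using c0(1) by (simp add: cech_cochains_def)
  moreover have "\<phi> s \<notin> \<phi> ` (?T - {s})"
    using bij s by (auto simp: bij_betw_def inj_on_def)
  then have "Poly_Mapping.lookup (cech_expo (?T - {s})) (w (\<phi> s)) = 0"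
    using expo by (metis gr0I)
  ultimately have "0 \<le> Poly_Mapping.lookup \<gamma> (w (\<phi> s))"
    using localization_nonneg \<gamma> by blast
  with neg[of "\<phi> s"] show False by simp
qed

lemma sum_one_exceptional:
  "(\<Sum>i\<in>UNIV. if i = i0 then a else - 1) = a - int (CARD('i) - 1)" for i0 :: "'i::finite"
proof -
  have "(\<Sum>i\<in>UNIV. if i = i0 then a else - 1) = a + (\<Sum>i\<in>UNIV - {i0}. - 1)"
    by (subst sum.remove[of _ i0]) (auto intro!: sum.cong)
  then show ?thesis by (simp add: card_Diff_singleton)
qed

lemma regularityD:
  assumes "(a, b) \<in> regularity I" "a - int lx \<le> a'" "b - int ly \<le> b'"
  shows "is_singleton (local_cohomology I (Suc (lx + ly)) (a', b'))"
  using assms unfolding regularity_def by fastforce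

text \<open>In the cocycle for a negative \<open>a\<close>, the exponents of the \<open>x\<close>-variables are \<open>a\<close> once and \<open>- 1\<close> otherwise, with
  sum \<open>a - n\<close>, the smallest value of the first degree that the condition with \<open>\<lambda>_x = n\<close> covers. In the second
  degree \<open>\<lambda>_y = 0\<close>, so any degree from \<open>b\<close> on is covered; replacing \<open>b\<close> by \<open>max b 0\<close> keeps the exponents
  of the \<open>y\<close>-variables nonnegative. The case of a negative \<open>b\<close> is symmetric.\<close>

lemma regularity_nonneg:
  fixes I :: "('n::{finite,linorder}, 'm::{finite,linorder}, 'k::field) bipoly set"
  assumes sub: "ring_ideal.subspace I" and pow: "ideal_power irrelevant_ideal t \<subseteq> I"
    and reg: "(a, b) \<in> regularity I"
  shows "0 \<le> a" "0 \<le> b"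
proof -
  obtain i0 :: 'n and j0 :: 'm where True by blast
  show "0 \<le> a"
  proof (rule ccontr)
    assume "\<not> 0 \<le> a"
    define \<gamma> where "\<gamma> = Abs_poly_mapping
      (case_var (\<lambda>i. if i = i0 then a else - 1) (\<lambda>j. if j = j0 then max b 0 else 0))"
    have "\<not> is_singleton (local_cohomology I CARD('n) (bidegree \<gamma>))"
    proof (rule pulled_back_top_class[OF sub pow, where \<phi> = fst and w = X and \<sigma> = "\<lambda>i. (i, j0)"])
      show "0 \<le> Poly_Mapping.lookup \<gamma> v" if "v \<notin> range X" for v
        using that by (cases v) (auto simp: \<gamma>_def)
    qed (use \<open>\<not> 0 \<le> a\<close> in \<open>auto simp: \<gamma>_def lookup_cech_expo_X\<close>)
    moreover have "bidegree \<gamma> = (a - int (CARD('n) - 1), max b 0)"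
      by (simp add: bidegree_def \<gamma>_def sum_one_exceptional)
    moreover have "CARD('n) = Suc (CARD('n) - 1 + 0)" by simp
    ultimately show False
      using regularityD[OF reg, of "CARD('n) - 1" _ 0 "max b 0"]
      by (metis diff_0_right max.cobounded1 of_nat_0 order_refl)
  qed
  show "0 \<le> b"
  proof (rule ccontr)
    assume "\<not> 0 \<le> b"
    define \<gamma> where "\<gamma> = Abs_poly_mapping
      (case_var (\<lambda>i. if i = i0 then max a 0 else 0) (\<lambda>j. if j = j0 then b else - 1))"
    have "\<not> is_singleton (local_cohomology I CARD('m) (bidegree \<gamma>))"
    proof (rule pulled_back_top_class[OF sub pow, where \<phi> = snd and w = Y and \<sigma> = "\<lambda>j. (i0, j)"])
      show "0 \<le> Poly_Mapping.lookup \<gamma> v" if "v \<notin> range Y" for v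
        using that by (cases v) (auto simp: \<gamma>_def)
    qed (use \<open>\<not> 0 \<le> b\<close> in \<open>auto simp: \<gamma>_def lookup_cech_expo_Y\<close>)
    moreover have "bidegree \<gamma> = (max a 0, b - int (CARD('m) - 1))"
      by (simp add: bidegree_def \<gamma>_def sum_one_exceptional)
    moreover have "CARD('m) = Suc (0 + (CARD('m) - 1))" by simp
    ultimately show False
      using regularityD[OF reg, of 0 "max a 0" "CARD('m) - 1"]
      by (metis diff_0_right max.cobounded1 of_nat_0 order_refl)
  qed
qed


section \<open>Generators of the bigeneric initial ideal\<close>

theorem corollary3p2:
  fixes I J :: "('n::{finite,linorder}, 'm::{finite,linorder}, 'k::field_char_0) bipoly set"
    and a b a' b' :: int
  assumes "bihomogeneous_ideal I"
    and "defines_empty_subscheme I"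
    and "is_bigin J I"
    and "(a, b) \<in> regularity I"
    and "a \<le> a'" and "b \<le> b'" and "(a', b') \<noteq> (a, b)"
  shows "\<not> (\<exists>e. minimal_generator J e \<and> map_prod int int (bidegree e) = (a', b'))"
proof
  assume "\<exists>e. minimal_generator J e \<and> map_prod int int (bidegree e) = (a', b')"
  then obtain e where gen: "minimal_generator J e" and e: "map_prod int int (bidegree e) = (a', b')"
    by blast
  have sub: "ring_ideal.subspace I"
    using assms(1) unfolding bihomogeneous_ideal_def by (auto simp: ring_ideal.subspace_span)
  obtain t where pow: "ideal_power irrelevant_ideal t \<subseteq> I"
    using assms(2) unfolding defines_empty_subscheme_def by blast
  have "0 \<le> a" "0 \<le> b" using regularity_nonneg[OF sub pow assms(4)] by simp_all
  then obtain k l where kl: "a = int k" "b = int l" by (metis nonneg_int_cases)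
  have I: "monom f \<in> I" if "bidegree f = (k, l)" for f
    using monom_in_ideal_if_H1_zero[OF sub pow, of f] regularityD[OF assms(4), of 0 a 0 b]
    by (simp add: that kl)
  obtain U where "zariski_open U" "U \<noteq> {}" and U: "\<And>u. u \<in> U \<Longrightarrow> initial_ideal (gl_act u ` I) = J"
    using assms(3) unfolding is_bigin_def by blast
  then obtain u where u: "u \<in> U" "u \<in> GL2" unfolding zariski_open_def by auto
  have "k \<le> fst (bidegree e)" "l \<le> snd (bidegree e)"
    using e assms(5,6) kl by (auto simp: map_prod_def split: prod.splits)
  then obtain f where f: "\<And>v. Poly_Mapping.lookup f v \<le> Poly_Mapping.lookup e v" "bidegree f = (k, l)"
    using monomial_divisor_of_bidegree by blast
  have "monom f \<in> gl_act u ` I"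
    using I f(2) by (intro monom_in_coordinate_change[OF u(2) sub]) simp
  then have "(monom f :: ('n, 'm, 'k) bipoly)
      \<in> {monom (lead_expo p) | p. p \<in> gl_act u ` I \<and> p \<noteq> 0}"
    by (intro CollectI exI[of _ "monom f"]) (simp add: lead_expo_monom)
  then have "monom f \<in> J"
    unfolding U[OF u(1), symmetric] initial_ideal_def by (rule ring_ideal.span_base)
  moreover have "e - f \<noteq> 0"
  proof
    assume "e - f = 0"
    then have "e = f" using expo_le_split[OF f(1)] by simp
    with e f(2) kl assms(7) show False by simp
  qed
  ultimately show False
    using proper_multiple_not_minimal_generator gen expo_le_split[OF f(1)] by metis
qed

end
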